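(* Let $a>b>0$, $c=\sqrt{a^2-b^2}$, let $\mathcal{E}$ be the ellipse $(x/a)^2+(y/b)^2=1$, and let $k_7=\sqrt{4a^4-5a^2b^2+b^4}$. For every triangle of the iso-$X_7$ family, i.e., the Poncelet family of triangles inscribed in $\mathcal{E}$ whose common incircle has center $\left[\frac{k_7}{2a},0\right]$ and radius $r=\frac{b^2}{2a}$, the squared distance between the incenter $X_1$ and the Gergonne point $X_7$, which for a generic triangle equals $r^2\left[1-\frac{3s^2}{(r+4R)^2}\right]$ (with $r$, $R$, $s$ the inradius, circumradius and semiperimeter), reduces to $$|X_1-X_7|^2=\frac{b^4c^2}{4a^2(4a^2-b^2)}.$$
   Context: Points of the plane are written $[x,y]$. The Poncelet family of triangles inscribed in $\mathcal{E}$ with a given circle as incircle (caustic) is the set of all triangles with vertices on $\mathcal{E}$ whose three sides are tangent to the circle; for the circle given, every point of $\mathcal{E}$ is a vertex of such a triangle. The Gergonne point $X_7$ of a triangle is the point of concurrence of the lines joining each vertex to the point where the incircle touches the opposite side. *)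

theory Defs
  imports "HOL-Analysis.Analysis"
begin

definition is_triangle :: "real^2 \<Rightarrow> real^2 \<Rightarrow> real^2 \<Rightarrow> bool" where
  "is_triangle A B C \<longleftrightarrow> \<not> collinear {A, B, C}"

definition ellipse :: "real \<Rightarrow> real \<Rightarrow> (real^2) set" where
  "ellipse a b = {p. (p $ 1 / a)\<^sup>2 + (p $ 2 / b)\<^sup>2 = 1}"

definition touches_line_at ::
    "real^2 \<Rightarrow> real \<Rightarrow> real^2 \<Rightarrow> real^2 \<Rightarrow> real^2 \<Rightarrow> bool" where
  "touches_line_at p r P Q T \<longleftrightarrow> sphere p r \<inter> affine hull {P, Q} = {T}"

(* Tangency to a side of a triangle: the point of contact lies on the segment, not merely on
   its extension.  Requiring this for all three sides excludes the excircles. *)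
definition touches_side :: "real^2 \<Rightarrow> real \<Rightarrow> real^2 \<Rightarrow> real^2 \<Rightarrow> bool" where
  "touches_side p r P Q \<longleftrightarrow> (\<exists>T \<in> closed_segment P Q. touches_line_at p r P Q T)"

definition is_incircle :: "real^2 \<Rightarrow> real^2 \<Rightarrow> real^2 \<Rightarrow> real^2 \<Rightarrow> real \<Rightarrow> bool" where
  "is_incircle A B C p r \<longleftrightarrow>
     r > 0 \<and> touches_side p r B C \<and> touches_side p r C A \<and> touches_side p r A B"

(* The definite descriptions below are meaningful for nondegenerate triangles only. *)
definition incenter :: "real^2 \<Rightarrow> real^2 \<Rightarrow> real^2 \<Rightarrow> real^2" where
  "incenter A B C = (THE p. \<exists>r. is_incircle A B C p r)"

definition inradius :: "real^2 \<Rightarrow> real^2 \<Rightarrow> real^2 \<Rightarrow> real" where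
  "inradius A B C = (THE r. \<exists>p. is_incircle A B C p r)"

definition circumradius :: "real^2 \<Rightarrow> real^2 \<Rightarrow> real^2 \<Rightarrow> real" where
  "circumradius A B C = (THE R. \<exists>q. {A, B, C} \<subseteq> sphere q R)"

definition semiperimeter :: "real^2 \<Rightarrow> real^2 \<Rightarrow> real^2 \<Rightarrow> real" where
  "semiperimeter A B C = (dist A B + dist B C + dist C A) / 2"

definition contact_point :: "real^2 \<Rightarrow> real \<Rightarrow> real^2 \<Rightarrow> real^2 \<Rightarrow> real^2" where
  "contact_point p r P Q = (THE T. touches_line_at p r P Q T)"

definition gergonne_point :: "real^2 \<Rightarrow> real^2 \<Rightarrow> real^2 \<Rightarrow> real^2" where
  "gergonne_point A B C =
     (let p = incenter A B C; r = inradius A B C in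
      THE G. G \<in> affine hull {A, contact_point p r B C} \<and>
             G \<in> affine hull {B, contact_point p r C A} \<and>
             G \<in> affine hull {C, contact_point p r A B})"

definition poncelet_triangles ::
    "(real^2) set \<Rightarrow> real^2 \<Rightarrow> real \<Rightarrow> ((real^2) \<times> (real^2) \<times> (real^2)) set" where
  "poncelet_triangles E p r =
     {(A, B, C). is_triangle A B C \<and> {A, B, C} \<subseteq> E \<and> is_incircle A B C p r}"

end

theory Submission
  imports Defs
begin

text \<open>
  The distance formula for an arbitrary triangle is a computation in the three tangent lengths
  \<open>x\<close>, \<open>y\<close>, \<open>z\<close> from the vertices to the incircle.  A circle is the incircle exactly when the powers
  of the vertices are \<open>x\<^sup>2\<close>, \<open>y\<^sup>2\<close>, \<open>z\<^sup>2\<close> (\<open>is_incircle_iff\<close>); this fixes the incenter, gives the inner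
  products of the vertices seen from it, and gives the contact points.  The Gergonne point has
  barycentric coordinates \<open>y * z\<close>, \<open>z * x\<close>, \<open>x * y\<close>, so with \<open>q = y * z + z * x + x * y\<close> and incenter \<open>I\<close>,
  Gergonne point \<open>G\<close> and inradius \<open>r\<close> one finds
  \<open>q\<^sup>2 * (dist I G)\<^sup>2 = r\<^sup>2 * q\<^sup>2 - 3 * (x * y * z)\<^sup>2\<close> (\<open>incenter_gergonne_tangent_lengths\<close>).  Heron's
  formula turns \<open>x * y * z\<close> into \<open>r\<^sup>2 * s\<close>, and \<open>q\<close> is \<open>r * (r + 4 * R)\<close>
  (\<open>inradius_circumradius\<close>).

  For the Poncelet family the Gergonne point is the same for all triangles, which makes its distance
  from the common incenter constant.  Normalize the caustic to the unit circle of the complex plane,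
  with contact points \<open>u\<close>, \<open>v\<close>, \<open>w\<close>.  The vertex between \<open>v\<close> and \<open>w\<close> is \<open>2 * v * w / (v + w)\<close>, and its lying
  on the ellipse is a symmetric biquadratic equation in \<open>v\<close> and \<open>w\<close> (\<open>vertex_on_ellipse\<close>).  The three
  equations for the three pairs together force
  \<open>K * (u * v + v * w + w * u + 3) = 2 * (u + v + w)\<close> with the real constant
  \<open>K = k7 / (4 * a\<^sup>2 - b\<^sup>2)\<close> (\<open>poncelet_contact_relation\<close>).  This relation says precisely that the three
  cevians pass through \<open>K\<close> (\<open>cevian_through_real_point\<close>).  The distance sought is therefore
  \<open>r * K\<close>, and \<open>k7\<^sup>2 = (4 * a\<^sup>2 - b\<^sup>2) * (a\<^sup>2 - b\<^sup>2)\<close> gives the closed form.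
\<close>

section \<open>Plane vectors\<close>

definition cross2 :: "real^2 \<Rightarrow> real^2 \<Rightarrow> real" where
  "cross2 u v = u $ 1 * v $ 2 - u $ 2 * v $ 1"

lemma inner_real2: "(u :: real^2) \<bullet> v = u $ 1 * v $ 1 + u $ 2 * v $ 2"
  by (simp add: inner_vec_def sum_2)

lemma cross2_power2: "(cross2 u v)\<^sup>2 = (u \<bullet> u) * (v \<bullet> v) - (u \<bullet> v)\<^sup>2"
  unfolding cross2_def inner_real2 by algebra

lemma collinear_if_cross2_eq_0:
  assumes "cross2 (B - A) (C - A) = 0"
  shows "collinear {A, B, C}"
proof -
  have "((B - A) \<bullet> (C - A))\<^sup>2 = (norm (B - A) * norm (C - A))\<^sup>2"
    using cross2_power2[of "B - A" "C - A"] assms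
    by (simp add: power_mult_distrib power2_norm_eq_inner)
  hence "\<bar>(B - A) \<bullet> (C - A)\<bar> = norm (B - A) * norm (C - A)"
    by (auto simp: power2_eq_iff abs_mult)
  hence "collinear {0, B - A, C - A}"
    by (simp add: norm_cauchy_schwarz_equal)
  hence "collinear {B, A, C}" by (subst collinear_3) auto
  thus ?thesis by (simp add: insert_commute)
qed

text \<open>
  This is how every uniqueness claim about the incenter and the circumcenter is settled: two
  candidates with the same prescribed squared distances to the vertices, up to a common constant,
  have a difference orthogonal to two sides.
\<close>

lemma orthogonal_to_two_sides_eq_0:
  assumes "is_triangle A B C" "w \<bullet> (B - A) = 0" "w \<bullet> (C - A) = 0"
  shows "w = 0"
proof -
  define u v where "u = B - A" and "v = C - A"
  have 1: "cross2 u v \<noteq> 0"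
    using assms(1) collinear_if_cross2_eq_0 unfolding is_triangle_def u_def v_def by blast
  have "w $ 1 * cross2 u v = (w \<bullet> u) * v $ 2 - (w \<bullet> v) * u $ 2"
       "w $ 2 * cross2 u v = (w \<bullet> v) * u $ 1 - (w \<bullet> u) * v $ 1"
    by (simp_all add: cross2_def inner_real2 algebra_simps)
  hence "w $ 1 = 0" "w $ 2 = 0" using assms(2,3) 1 by (simp_all add: u_def v_def)
  thus ?thesis by (simp add: vec_eq_iff forall_2)
qed

lemma is_triangle_rotate: "is_triangle A B C \<Longrightarrow> is_triangle B C A"
  by (simp add: is_triangle_def insert_commute)

lemma is_triangle_distinct: "is_triangle A B C \<Longrightarrow> A \<noteq> B"
  by (auto simp: is_triangle_def)

section \<open>Tangency and tangent lengths\<close>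

text \<open>
  A line through a point \<open>T\<close> of a circle that is not perpendicular to the radius meets the circle a
  second time, at the reflection of \<open>T\<close> in the foot of the perpendicular from the center.
\<close>

lemma touches_line_at_iff:
  assumes "P \<noteq> Q"
  shows "touches_line_at p r P Q T \<longleftrightarrow>
           T \<in> affine hull {P, Q} \<and> dist T p = r \<and> (T - p) \<bullet> (Q - P) = 0"
proof -
  define n where "n = (Q - P) \<bullet> (Q - P)"
  have n: "n > 0" using assms by (simp add: n_def)
  have sq: "(dist (T + k *\<^sub>R (Q - P)) p)\<^sup>2 =
              (dist T p)\<^sup>2 + k * (2 * ((T - p) \<bullet> (Q - P)) + k * n)" for k
    unfolding dist_norm power2_norm_eq_inner n_def
    by (simp add: inner_simps inner_commute algebra_simps)
  have shift: "X \<in> affine hull {P, Q} \<longleftrightarrow> (\<exists>k. X = T + k *\<^sub>R (Q - P))"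
    if T: "T \<in> affine hull {P, Q}" for X
  proof -
    obtain t where t: "T = P + t *\<^sub>R (Q - P)" using T by (auto simp: affine_hull_2_alt)
    show ?thesis
    proof
      assume "X \<in> affine hull {P, Q}"
      then obtain s where "X = P + s *\<^sub>R (Q - P)" by (auto simp: affine_hull_2_alt)
      hence "X = T + (s - t) *\<^sub>R (Q - P)" by (simp add: t algebra_simps)
      thus "\<exists>k. X = T + k *\<^sub>R (Q - P)" ..
    next
      assume "\<exists>k. X = T + k *\<^sub>R (Q - P)"
      then obtain k where "X = P + (t + k) *\<^sub>R (Q - P)" by (auto simp: t algebra_simps)
      thus "X \<in> affine hull {P, Q}" by (auto simp: affine_hull_2_alt)
    qed
  qed
  show ?thesis
  proof
    assume L: "touches_line_at p r P Q T"
    hence T: "T \<in> affine hull {P, Q}" and d: "dist T p = r"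
      by (auto simp: touches_line_at_def dist_commute)
    \<comment> \<open>the parameter of that reflection of \<open>T\<close>\<close>
    define k where "k = - 2 * ((T - p) \<bullet> (Q - P)) / n"
    have "(dist (T + k *\<^sub>R (Q - P)) p)\<^sup>2 = (dist T p)\<^sup>2"
      unfolding sq using n by (simp add: k_def)
    hence "dist (T + k *\<^sub>R (Q - P)) p = r" using d by (metis power2_eq_imp_eq zero_le_dist)
    hence "T + k *\<^sub>R (Q - P) \<in> sphere p r \<inter> affine hull {P, Q}"
      using shift[OF T] by (auto simp: dist_commute)
    hence "T + k *\<^sub>R (Q - P) = T" using L unfolding touches_line_at_def by blast
    hence "k = 0" using assms by simp
    thus "T \<in> affine hull {P, Q} \<and> dist T p = r \<and> (T - p) \<bullet> (Q - P) = 0"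
      using T d n by (simp add: k_def)
  next
    assume R: "T \<in> affine hull {P, Q} \<and> dist T p = r \<and> (T - p) \<bullet> (Q - P) = 0"
    have "X = T" if X: "X \<in> sphere p r" "X \<in> affine hull {P, Q}" for X
    proof -
      obtain k where k: "X = T + k *\<^sub>R (Q - P)" using X(2) shift R by blast
      have "(dist X p)\<^sup>2 = (dist T p)\<^sup>2" using X(1) R by (simp add: dist_commute)
      hence "k * (k * n) = 0" unfolding k sq using R by simp
      thus ?thesis using n k by simp
    qed
    thus "touches_line_at p r P Q T"
      using R by (auto simp: touches_line_at_def dist_commute)
  qed
qed

lemma contact_point_eqI: "touches_line_at p r P Q T \<Longrightarrow> contact_point p r P Q = T"
  unfolding contact_point_def touches_line_at_def by auto

lemma dist_power2_orthogonal:
  assumes "(T - p) \<bullet> (P - T) = 0"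
  shows "(dist P p)\<^sup>2 = (dist T p)\<^sup>2 + (dist P T)\<^sup>2"
proof -
  have "P - p = (T - p) + (P - T)" by simp
  thus ?thesis using norm_add_Pythagorean[of "T - p" "P - T"] assms
    by (simp add: orthogonal_def dist_norm)
qed

lemma touches_line_at_dist:
  assumes "P \<noteq> Q" "touches_line_at p r P Q T"
  shows "(dist P p)\<^sup>2 = r\<^sup>2 + (dist P T)\<^sup>2" "(dist Q p)\<^sup>2 = r\<^sup>2 + (dist Q T)\<^sup>2"
proof -
  have T: "T \<in> affine hull {P, Q}" "dist T p = r" "(T - p) \<bullet> (Q - P) = 0"
    using assms touches_line_at_iff by blast+
  obtain t where t: "T = P + t *\<^sub>R (Q - P)" using T(1) by (auto simp: affine_hull_2_alt)
  have "P - T = (- t) *\<^sub>R (Q - P)" "Q - T = (1 - t) *\<^sub>R (Q - P)"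
    by (simp_all add: t algebra_simps)
  hence "(T - p) \<bullet> (P - T) = 0" "(T - p) \<bullet> (Q - T) = 0" using T(3) by auto
  thus "(dist P p)\<^sup>2 = r\<^sup>2 + (dist P T)\<^sup>2" "(dist Q p)\<^sup>2 = r\<^sup>2 + (dist Q T)\<^sup>2"
    using dist_power2_orthogonal T(2) by metis+
qed

text \<open>
  The squared tangent lengths are the powers of \<open>P\<close> and \<open>Q\<close> with respect to the circle, and they
  already determine tangency: the point dividing the segment in the ratio of the tangent lengths
  lies on the circle and on the polar of both endpoints.  The two inner products are what later
  turns a vertex into the intersection of two tangents of the circle.
\<close>

lemma contact_from_tangent_lengths:
  fixes P Q p :: "real^2"
  assumes "P \<noteq> Q" "r > 0" "s \<ge> 0" "t \<ge> 0" "s + t = dist P Q"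
    and P: "(dist P p)\<^sup>2 = r\<^sup>2 + s\<^sup>2" and Q: "(dist Q p)\<^sup>2 = r\<^sup>2 + t\<^sup>2"
  defines "T \<equiv> (t / (s + t)) *\<^sub>R P + (s / (s + t)) *\<^sub>R Q"
  shows "touches_line_at p r P Q T" "T \<in> closed_segment P Q"
    "(P - p) \<bullet> (T - p) = r\<^sup>2" "(Q - p) \<bullet> (T - p) = r\<^sup>2" "dist T p = r"
proof -
  define x y where "x = P - p" and "y = Q - p"
  have l: "s + t > 0" using assms(1,5) by simp
  have xx: "x \<bullet> x = r\<^sup>2 + s\<^sup>2" and yy: "y \<bullet> y = r\<^sup>2 + t\<^sup>2"
    using P Q by (simp_all add: dist_norm power2_norm_eq_inner x_def y_def)
  have "(x - y) \<bullet> (x - y) = (s + t)\<^sup>2"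
    unfolding assms(5) x_def y_def by (simp add: dist_norm power2_norm_eq_inner)
  hence xy: "x \<bullet> y = r\<^sup>2 - s * t" using xx yy
    by (simp add: inner_simps inner_commute power2_eq_square algebra_simps)
  have st: "t / (s + t) = 1 - s / (s + t)" using l by (simp add: field_simps)
  have T: "T - p = (1 / (s + t)) *\<^sub>R (t *\<^sub>R x + s *\<^sub>R y)"
  proof -
    have "T - p = (t / (s + t)) *\<^sub>R x + (s / (s + t)) *\<^sub>R y"
      unfolding T_def x_def y_def st by (simp add: algebra_simps)
    thus ?thesis by (simp add: scaleR_add_right)
  qed
  have "t * (r\<^sup>2 + s\<^sup>2) + s * (r\<^sup>2 - s * t) = (s + t) * r\<^sup>2"
    "t * (r\<^sup>2 - s * t) + s * (r\<^sup>2 + t\<^sup>2) = (s + t) * r\<^sup>2" by algebra+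
  hence "t * (x \<bullet> x) + s * (x \<bullet> y) = (s + t) * r\<^sup>2" "t * (y \<bullet> x) + s * (y \<bullet> y) = (s + t) * r\<^sup>2"
    using xx yy xy by (simp_all add: inner_commute)
  thus i1: "(P - p) \<bullet> (T - p) = r\<^sup>2" and i2: "(Q - p) \<bullet> (T - p) = r\<^sup>2"
    unfolding T x_def[symmetric] y_def[symmetric] using l
    by (simp_all add: inner_add_right)
  have "(T - p) \<bullet> (T - p) = (1 / (s + t)) * (t * (x \<bullet> (T - p)) + s * (y \<bullet> (T - p)))"
    by (subst (1) T) (simp add: inner_add_left)
  also have "\<dots> = (1 / (s + t)) * ((s + t) * r\<^sup>2)"
    using i1 i2 unfolding x_def[symmetric] y_def[symmetric] by (simp only: distrib_right add.commute)
  also have "\<dots> = r\<^sup>2" using l by simp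
  finally have "(dist T p)\<^sup>2 = r\<^sup>2" by (simp add: dist_norm power2_norm_eq_inner)
  thus d: "dist T p = r" using assms(2) by (simp add: power2_eq_iff_nonneg)
  show seg: "T \<in> closed_segment P Q"
    unfolding closed_segment_def using l assms(3,4)
    by (auto simp: T_def st intro!: exI[of _ "s / (s + t)"])
  have "(T - p) \<bullet> (Q - P) = 0" using i1 i2
    by (simp add: inner_commute inner_diff_right inner_diff_left)
  thus "touches_line_at p r P Q T"
    using touches_line_at_iff[OF assms(1)] d seg
    by (metis (no_types, lifting) convex_hull_subset_affine_hull segment_convex_hull subsetD)
qed

text \<open>
  Restated in this way, tangency to a side no longer mentions the point of contact.
\<close>

lemma touches_side_iff:
  assumes "P \<noteq> Q" "r > 0"
  shows "touches_side p r P Q \<longleftrightarrow>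
    (\<exists>s\<ge>0. \<exists>t\<ge>0. s + t = dist P Q \<and> (dist P p)\<^sup>2 = r\<^sup>2 + s\<^sup>2 \<and> (dist Q p)\<^sup>2 = r\<^sup>2 + t\<^sup>2)"
proof
  assume "touches_side p r P Q"
  then obtain T where T: "T \<in> closed_segment P Q" "touches_line_at p r P Q T"
    by (auto simp: touches_side_def)
  have "dist P T + dist Q T = dist P Q"
    using T(1) between[of P Q T] by (simp add: between_mem_segment dist_commute)
  thus "\<exists>s\<ge>0. \<exists>t\<ge>0. s + t = dist P Q \<and> (dist P p)\<^sup>2 = r\<^sup>2 + s\<^sup>2 \<and> (dist Q p)\<^sup>2 = r\<^sup>2 + t\<^sup>2"
    using touches_line_at_dist[OF assms(1) T(2)] zero_le_dist by blast
next
  assume "\<exists>s\<ge>0. \<exists>t\<ge>0. s + t = dist P Q \<and> (dist P p)\<^sup>2 = r\<^sup>2 + s\<^sup>2 \<and> (dist Q p)\<^sup>2 = r\<^sup>2 + t\<^sup>2"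
  thus "touches_side p r P Q"
    using contact_from_tangent_lengths[OF assms] unfolding touches_side_def by blast
qed

section \<open>The incircle of a triangle\<close>

text \<open>
  The distance from \<open>A\<close> to the two adjacent points of contact of the incircle, usually written as the
  semiperimeter minus the opposite side.  All quantities attached to the triangle are expressed
  through the three tangent lengths.
\<close>

definition tangent_length :: "real^2 \<Rightarrow> real^2 \<Rightarrow> real^2 \<Rightarrow> real" where
  "tangent_length A B C = (dist A B + dist C A - dist B C) / 2"

lemma tangent_length_sum: "tangent_length A B C + tangent_length B C A = dist A B"
  by (simp add: tangent_length_def dist_commute field_simps)

lemma tangent_length_pos:
  assumes "is_triangle A B C"
  shows "tangent_length A B C > 0"
proof (rule ccontr)
  assume "\<not> ?thesis"
  hence "dist B C = dist B A + dist A C"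
    using dist_triangle[of B C A] by (simp add: tangent_length_def dist_commute)
  hence "collinear {B, A, C}" by (simp add: between between_imp_collinear)
  thus False using assms by (simp add: is_triangle_def insert_commute)
qed

text \<open>
  The two sides at a vertex give the same tangent length, since both are the square root of the power
  of that vertex; the three sums equal to the sides are then a linear system that determines the
  tangent lengths.  So the incenter is the radical center of the circles about the vertices with these
  lengths as radii, and existence and uniqueness of the incircle become statements about three
  squared distances.
\<close>

lemma is_incircle_iff:
  assumes tri: "is_triangle A B C"
  shows "is_incircle A B C p r \<longleftrightarrow> r > 0 \<and>
    (dist A p)\<^sup>2 = r\<^sup>2 + (tangent_length A B C)\<^sup>2 \<and>
    (dist B p)\<^sup>2 = r\<^sup>2 + (tangent_length B C A)\<^sup>2 \<and>
    (dist C p)\<^sup>2 = r\<^sup>2 + (tangent_length C A B)\<^sup>2" (is "?L \<longleftrightarrow> ?R")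
proof
  have ne: "A \<noteq> B" "B \<noteq> C" "C \<noteq> A"
    using tri is_triangle_rotate is_triangle_distinct by blast+
  show ?R if ?L
  proof -
    have r: "r > 0" and touch: "touches_side p r A B" "touches_side p r B C" "touches_side p r C A"
      using that by (simp_all add: is_incircle_def)
    obtain y z where yz: "y \<ge> 0" "z \<ge> 0" "y + z = dist B C"
      "(dist B p)\<^sup>2 = r\<^sup>2 + y\<^sup>2" "(dist C p)\<^sup>2 = r\<^sup>2 + z\<^sup>2"
      using touch(2)[unfolded touches_side_iff[OF ne(2) r]] by blast
    obtain z' x where zx: "z' \<ge> 0" "x \<ge> 0" "z' + x = dist C A"
      "(dist C p)\<^sup>2 = r\<^sup>2 + z'\<^sup>2" "(dist A p)\<^sup>2 = r\<^sup>2 + x\<^sup>2"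
      using touch(3)[unfolded touches_side_iff[OF ne(3) r]] by blast
    obtain x' y' where xy: "x' \<ge> 0" "y' \<ge> 0" "x' + y' = dist A B"
      "(dist A p)\<^sup>2 = r\<^sup>2 + x'\<^sup>2" "(dist B p)\<^sup>2 = r\<^sup>2 + y'\<^sup>2"
      using touch(1)[unfolded touches_side_iff[OF ne(1) r]] by blast
    have "x' = x" "y' = y" "z' = z" using yz zx xy by (auto simp: power2_eq_iff_nonneg)
    hence "x = tangent_length A B C" "y = tangent_length B C A" "z = tangent_length C A B"
      using yz(3) zx(3) xy(3) by (auto simp: tangent_length_def)
    thus ?R using r yz zx by simp
  qed
  show ?L if ?R
  proof -
    have r: "r > 0" using that by simp
    have pos: "tangent_length A B C \<ge> 0" "tangent_length B C A \<ge> 0" "tangent_length C A B \<ge> 0"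
      using tangent_length_pos tri is_triangle_rotate by (metis less_imp_le)+
    have "touches_side p r A B" "touches_side p r B C" "touches_side p r C A"
      unfolding touches_side_iff[OF ne(1) r] touches_side_iff[OF ne(2) r] touches_side_iff[OF ne(3) r]
      using that pos tangent_length_sum[of A B C] tangent_length_sum[of B C A]
        tangent_length_sum[of C A B] by auto
    thus ?L using r by (simp add: is_incircle_def)
  qed
qed

lemma is_incircle_unique:
  assumes tri: "is_triangle A B C" and "is_incircle A B C p r" "is_incircle A B C p' r'"
  shows "p' = p" "r' = r"
proof -
  note i = assms(2,3)[unfolded is_incircle_iff[OF tri]]
  have lin: "(dist X p)\<^sup>2 - (dist A p)\<^sup>2 - ((dist X p')\<^sup>2 - (dist A p')\<^sup>2) = 2 * ((p' - p) \<bullet> (X - A))" for X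
    unfolding dist_norm power2_norm_eq_inner by (simp add: inner_simps inner_commute algebra_simps)
  have "(p' - p) \<bullet> (B - A) = 0" "(p' - p) \<bullet> (C - A) = 0"
    using lin[of B] lin[of C] i by auto
  thus p: "p' = p" using orthogonal_to_two_sides_eq_0[OF tri] by force
  have "r'\<^sup>2 = r\<^sup>2" using i p by simp
  thus "r' = r" using i by (simp add: power2_eq_iff_nonneg)
qed

lemma incenter_inradius_eqI:
  assumes "is_triangle A B C" "is_incircle A B C p r"
  shows "incenter A B C = p" "inradius A B C = r"
proof -
  note unique = is_incircle_unique[OF assms(1) assms(2)]
  show "incenter A B C = p"
    unfolding incenter_def by (rule the_equality) (use assms(2) unique(1) in blast)+
  show "inradius A B C = r"
    unfolding inradius_def by (rule the_equality) (use assms(2) unique(2) in blast)+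
qed

text \<open>
  The center has barycentric coordinates proportional to the sides, and the square of the radius is
  the product of the tangent lengths over their sum (Heron).
\<close>

lemma is_incircle_exists:
  assumes tri: "is_triangle A B C"
  obtains p r where "is_incircle A B C p r"
    "r\<^sup>2 * (tangent_length A B C + tangent_length B C A + tangent_length C A B) =
       tangent_length A B C * tangent_length B C A * tangent_length C A B"
proof -
  define x y z where "x = tangent_length A B C" and "y = tangent_length B C A" 
    and "z = tangent_length C A B"
  have pos: "x > 0" "y > 0" "z > 0"
    using tangent_length_pos tri is_triangle_rotate unfolding x_def y_def z_def by metis+
  define s where "s = x + y + z"
  have s: "s > 0" using pos by (simp add: s_def)
  define r where "r = sqrt (x * y * z / s)"
  have r: "r > 0" "r\<^sup>2 = x * y * z / s" using pos s by (auto simp: r_def)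
  define P Q where "P = B - A" and "Q = C - A"
  have PP: "P \<bullet> P = (x + y)\<^sup>2" and QQ: "Q \<bullet> Q = (x + z)\<^sup>2"
    and "(P - Q) \<bullet> (P - Q) = (y + z)\<^sup>2"
    using tangent_length_sum[of A B C] tangent_length_sum[of C A B] tangent_length_sum[of B C A]
    by (simp_all add: x_def y_def z_def P_def Q_def dist_norm power2_norm_eq_inner 
          flip: power2_norm_eq_inner) (simp_all add: add.commute norm_minus_commute)
  hence PQ: "2 * (P \<bullet> Q) = (x + y)\<^sup>2 + (x + z)\<^sup>2 - (y + z)\<^sup>2"
    by (simp add: inner_simps inner_commute)
  \<comment> \<open>\<open>V\<close> leads from \<open>A\<close> to the incenter\<close>
  define V where "V = (1 / (2 * s)) *\<^sub>R ((x + z) *\<^sub>R P + (x + y) *\<^sub>R Q)"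
  have dist2: "4 * s\<^sup>2 * (dist (A + \<beta> *\<^sub>R P + \<gamma> *\<^sub>R Q) (A + V))\<^sup>2 =
     (x + z - 2 * s * \<beta>)\<^sup>2 * (x + y)\<^sup>2 + (x + y - 2 * s * \<gamma>)\<^sup>2 * (x + z)\<^sup>2
     + (x + z - 2 * s * \<beta>) * (x + y - 2 * s * \<gamma>) * ((x + y)\<^sup>2 + (x + z)\<^sup>2 - (y + z)\<^sup>2)" for \<beta> \<gamma>
  proof -
    define m n where "m = x + z - 2 * s * \<beta>" and "n = x + y - 2 * s * \<gamma>"
    have "(2 * s) *\<^sub>R (A + V - (A + \<beta> *\<^sub>R P + \<gamma> *\<^sub>R Q)) = m *\<^sub>R P + n *\<^sub>R Q"
      using s by (simp add: V_def m_def n_def algebra_simps)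
    hence "(2 * s)\<^sup>2 * (dist (A + \<beta> *\<^sub>R P + \<gamma> *\<^sub>R Q) (A + V))\<^sup>2 = (norm (m *\<^sub>R P + n *\<^sub>R Q))\<^sup>2"
      by (metis dist_norm dist_commute norm_scaleR power_mult_distrib power2_abs)
    moreover have "(norm (m *\<^sub>R P + n *\<^sub>R Q))\<^sup>2 = m\<^sup>2 * (P \<bullet> P) + n\<^sup>2 * (Q \<bullet> Q) + m * n * (2 * (P \<bullet> Q))"
      unfolding power2_norm_eq_inner
      by (simp add: inner_simps inner_commute power2_eq_square algebra_simps)
    ultimately show ?thesis unfolding PP QQ PQ m_def n_def by (simp add: power_mult_distrib)
  qed
  have rs: "4 * s\<^sup>2 * (r\<^sup>2 + t) = 4 * s * (x * y * z) + 4 * s\<^sup>2 * t" for t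
    using s unfolding r(2) by (simp add: field_simps power2_eq_square)
  have "4 * s\<^sup>2 * (dist A (A + V))\<^sup>2 = 4 * s\<^sup>2 * (r\<^sup>2 + x\<^sup>2)"
  proof -
    have "4 * s\<^sup>2 * (dist A (A + V))\<^sup>2 = (x + z)\<^sup>2 * (x + y)\<^sup>2 + (x + y)\<^sup>2 * (x + z)\<^sup>2
        + (x + z) * (x + y) * ((x + y)\<^sup>2 + (x + z)\<^sup>2 - (y + z)\<^sup>2)"
      using dist2[of 0 0] by simp
    also have "\<dots> = 4 * s\<^sup>2 * (r\<^sup>2 + x\<^sup>2)" unfolding rs unfolding s_def by algebra
    finally show ?thesis .
  qed
  moreover have "4 * s\<^sup>2 * (dist B (A + V))\<^sup>2 = 4 * s\<^sup>2 * (r\<^sup>2 + y\<^sup>2)"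
  proof -
    have "4 * s\<^sup>2 * (dist B (A + V))\<^sup>2 = (x + z - 2 * s)\<^sup>2 * (x + y)\<^sup>2 + (x + y)\<^sup>2 * (x + z)\<^sup>2
        + (x + z - 2 * s) * (x + y) * ((x + y)\<^sup>2 + (x + z)\<^sup>2 - (y + z)\<^sup>2)"
      using dist2[of 1 0] unfolding P_def by simp
    also have "\<dots> = 4 * s\<^sup>2 * (r\<^sup>2 + y\<^sup>2)" unfolding rs unfolding s_def by algebra
    finally show ?thesis .
  qed
  moreover have "4 * s\<^sup>2 * (dist C (A + V))\<^sup>2 = 4 * s\<^sup>2 * (r\<^sup>2 + z\<^sup>2)"
  proof -
    have "4 * s\<^sup>2 * (dist C (A + V))\<^sup>2 = (x + z)\<^sup>2 * (x + y)\<^sup>2 + (x + y - 2 * s)\<^sup>2 * (x + z)\<^sup>2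
        + (x + z) * (x + y - 2 * s) * ((x + y)\<^sup>2 + (x + z)\<^sup>2 - (y + z)\<^sup>2)"
      using dist2[of 0 1] unfolding Q_def by simp
    also have "\<dots> = 4 * s\<^sup>2 * (r\<^sup>2 + z\<^sup>2)" unfolding rs unfolding s_def by algebra
    finally show ?thesis .
  qed
  ultimately have "(dist A (A + V))\<^sup>2 = r\<^sup>2 + x\<^sup>2" "(dist B (A + V))\<^sup>2 = r\<^sup>2 + y\<^sup>2"
    "(dist C (A + V))\<^sup>2 = r\<^sup>2 + z\<^sup>2" using s by simp_all
  hence "is_incircle A B C (A + V) r"
    using is_incircle_iff[OF tri] r(1) by (simp add: x_def y_def z_def)
  moreover have "r\<^sup>2 * (x + y + z) = x * y * z" using r s by (simp add: s_def)
  ultimately show thesis using that by (simp add: x_def y_def z_def)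
qed


lemma incircle_radius:
  assumes "is_triangle A B C" "is_incircle A B C p r"
  shows "r\<^sup>2 * (tangent_length A B C + tangent_length B C A + tangent_length C A B) =
       tangent_length A B C * tangent_length B C A * tangent_length C A B"
  using is_incircle_exists[OF assms(1)] is_incircle_unique(2)[OF assms] by metis

text \<open>
  Heron's formula: the cross product is twice the signed area.
\<close>

lemma cross2_tangent_lengths:
  fixes A B C :: "real^2"
  defines "x \<equiv> tangent_length A B C" and "y \<equiv> tangent_length B C A" and "z \<equiv> tangent_length C A B"
  shows "(cross2 (B - A) (C - A))\<^sup>2 = 4 * (x + y + z) * (x * y * z)"
proof -
  define u v where "u = B - A" and "v = C - A"
  have uu: "u \<bullet> u = (x + y)\<^sup>2" and vv: "v \<bullet> v = (z + x)\<^sup>2" and "(u - v) \<bullet> (u - v) = (y + z)\<^sup>2"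
    unfolding x_def y_def z_def tangent_length_sum
    by (simp_all add: u_def v_def dist_norm power2_norm_eq_inner[symmetric] norm_minus_commute)
  hence uv: "2 * (u \<bullet> v) = (x + y)\<^sup>2 + (z + x)\<^sup>2 - (y + z)\<^sup>2"
    by (simp add: inner_simps inner_commute)
  have "4 * (cross2 u v)\<^sup>2 = 4 * (u \<bullet> u) * (v \<bullet> v) - (2 * (u \<bullet> v))\<^sup>2"
    unfolding cross2_power2 by (simp add: power_mult_distrib)
  also have "\<dots> = 4 * (4 * (x + y + z) * (x * y * z))" unfolding uu vv uv by algebra
  finally show ?thesis by (simp add: u_def v_def)
qed

section \<open>The circumradius\<close>

text \<open>
  The classical identity that the product of the sides is four times the circumradius times the
  area.
\<close>

lemma circumradius_cross2:
  assumes tri: "is_triangle A B C"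
  shows "circumradius A B C * (2 * \<bar>cross2 (B - A) (C - A)\<bar>) = dist A B * dist B C * dist C A"
proof -
  define u v where "u = B - A" and "v = C - A"
  define d where "d = cross2 u v"
  have d: "d \<noteq> 0"
    using tri collinear_if_cross2_eq_0 unfolding is_triangle_def d_def u_def v_def by blast
  \<comment> \<open>\<open>w\<close> leads from \<open>A\<close> to the circumcenter; it solves \<open>w \<bullet> u = u \<bullet> u / 2\<close> and
    \<open>w \<bullet> v = v \<bullet> v / 2\<close> by Cramer's rule\<close>
  define w0 w :: "real^2" where "w0 = (vector [(u \<bullet> u) * v $ 2 - (v \<bullet> v) * u $ 2,
     (v \<bullet> v) * u $ 1 - (u \<bullet> u) * v $ 1])" and "w = (1 / (2 * d)) *\<^sub>R w0"
  have "w0 \<bullet> u = d * (u \<bullet> u)" "w0 \<bullet> v = d * (v \<bullet> v)"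
    by (simp_all add: w0_def inner_real2 d_def cross2_def algebra_simps)
  hence wu: "w \<bullet> u = (u \<bullet> u) / 2" and wv: "w \<bullet> v = (v \<bullet> v) / 2"
    using d by (simp_all add: w_def)
  have "dist (A + w) A = norm w" by (simp add: dist_norm)
  moreover have "(dist (A + w) B)\<^sup>2 = (norm w)\<^sup>2"
  proof -
    have e: "A + w - B = w - u" by (simp add: u_def)
    show ?thesis unfolding dist_norm e power2_norm_eq_inner
      using wu by (simp add: inner_simps inner_commute)
  qed
  moreover have "(dist (A + w) C)\<^sup>2 = (norm w)\<^sup>2"
  proof -
    have e: "A + w - C = w - v" by (simp add: v_def)
    show ?thesis unfolding dist_norm e power2_norm_eq_inner
      using wv by (simp add: inner_simps inner_commute)
  qed
  ultimately have sph: "{A, B, C} \<subseteq> sphere (A + w) (norm w)"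
    by (simp add: power2_eq_iff_nonneg)
  have uniq: "R = norm w" if R: "{A, B, C} \<subseteq> sphere q R" for q R
  proof -
    have lin: "(dist q X)\<^sup>2 - (dist q A)\<^sup>2 - ((dist (A + w) X)\<^sup>2 - (dist (A + w) A)\<^sup>2)
        = 2 * ((A + w - q) \<bullet> (X - A))" for X
      unfolding dist_norm power2_norm_eq_inner by (simp add: inner_simps inner_commute algebra_simps)
    have "(A + w - q) \<bullet> (B - A) = 0" "(A + w - q) \<bullet> (C - A) = 0"
      using lin[of B] lin[of C] R sph by auto
    hence "q = A + w" using orthogonal_to_two_sides_eq_0[OF tri] by force
    thus ?thesis using R sph by simp
  qed
  have circ: "circumradius A B C = norm w"
    unfolding circumradius_def by (rule the_equality) (use sph uniq in blast)+
  have "(norm w0)\<^sup>2 = (u \<bullet> u) * (v \<bullet> v) * ((u - v) \<bullet> (u - v))"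
    unfolding power2_norm_eq_inner inner_real2 w0_def by simp algebra
  also have "\<dots> = (dist A B * dist B C * dist C A)\<^sup>2"
    unfolding power2_norm_eq_inner[symmetric]
    by (simp add: u_def v_def power_mult_distrib dist_norm norm_minus_commute)
  finally have "norm w0 = dist A B * dist B C * dist C A"
    by (simp add: power2_eq_iff_nonneg)
  moreover have "norm w0 = norm w * (2 * \<bar>d\<bar>)" using d by (simp add: w_def abs_mult)
  ultimately show ?thesis by (simp add: circ d_def u_def v_def)
qed

section \<open>Contact points and the Gergonne point\<close>

lemma is_incircle_rotate: "is_incircle A B C p r \<Longrightarrow> is_incircle B C A p r"
  by (simp add: is_incircle_def)

lemma incircle_contact_point:
  assumes tri: "is_triangle A B C" and inc: "is_incircle A B C p r"
  defines "y \<equiv> tangent_length B C A" and "z \<equiv> tangent_length C A B" 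
    and "D \<equiv> contact_point p r B C"
  shows "D = (z / (y + z)) *\<^sub>R B + (y / (y + z)) *\<^sub>R C"
    "(B - p) \<bullet> (D - p) = r\<^sup>2" "(C - p) \<bullet> (D - p) = r\<^sup>2" "dist D p = r"
proof -
  have ne: "B \<noteq> C" using tri is_triangle_rotate is_triangle_distinct by blast
  have yz: "y \<ge> 0" "z \<ge> 0" "y + z = dist B C" unfolding y_def z_def
    using tangent_length_pos tri is_triangle_rotate tangent_length_sum by (metis less_imp_le)+
  have r: "r > 0" "(dist B p)\<^sup>2 = r\<^sup>2 + y\<^sup>2" "(dist C p)\<^sup>2 = r\<^sup>2 + z\<^sup>2"
    using inc is_incircle_iff[OF tri] by (simp_all add: y_def z_def)
  note * = contact_from_tangent_lengths[OF ne r(1) yz r(2,3)]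
  show D: "D = (z / (y + z)) *\<^sub>R B + (y / (y + z)) *\<^sub>R C"
    unfolding D_def by (rule contact_point_eqI) (fact *)
  show "(B - p) \<bullet> (D - p) = r\<^sup>2" "(C - p) \<bullet> (D - p) = r\<^sup>2" "dist D p = r"
    unfolding D by (fact *)+
qed

lemma lines_meet_once:
  assumes "cross2 (D - A) (E - B) \<noteq> 0"
    and "G \<in> affine hull {A, D}" "G \<in> affine hull {B, E}"
    and "G' \<in> affine hull {A, D}" "G' \<in> affine hull {B, E}"
  shows "G' = G"
proof -
  obtain k l where "G = A + k *\<^sub>R (D - A)" "G' = A + l *\<^sub>R (D - A)"
    using assms by (auto simp: affine_hull_2_alt)
  hence t: "G' - G = (l - k) *\<^sub>R (D - A)" by (simp add: scaleR_diff_left)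
  obtain m n where "G = B + m *\<^sub>R (E - B)" "G' = B + n *\<^sub>R (E - B)"
    using assms by (auto simp: affine_hull_2_alt)
  hence "G' - G = (n - m) *\<^sub>R (E - B)" by (simp add: scaleR_diff_left)
  hence "cross2 (G' - G) (E - B) = 0" by (simp add: cross2_def)
  moreover have "cross2 (G' - G) (E - B) = (l - k) * cross2 (D - A) (E - B)"
    unfolding t by (simp add: cross2_def algebra_simps)
  ultimately show ?thesis using t assms(1) by simp
qed

text \<open>
  Two cevians that end inside different sides cross inside the triangle and are therefore not
  parallel.  So a point on all three cevians is the only one, and it suffices to exhibit it.
\<close>

lemma gergonne_point_eqI:
  assumes tri: "is_triangle A B C" and inc: "is_incircle A B C p r"
    and G: "G \<in> affine hull {A, contact_point p r B C}" "G \<in> affine hull {B, contact_point p r C A}"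
      "G \<in> affine hull {C, contact_point p r A B}"
  shows "gergonne_point A B C = G"
proof -
  define x y z where "x = tangent_length A B C" and "y = tangent_length B C A" 
    and "z = tangent_length C A B"
  have pos: "x > 0" "y > 0" "z > 0"
    using tangent_length_pos tri is_triangle_rotate unfolding x_def y_def z_def by metis+
  define D E where "D = contact_point p r B C" and "E = contact_point p r C A"
  define u v where "u = B - A" and "v = C - A"
  have "D = (z / (y + z)) *\<^sub>R B + (y / (y + z)) *\<^sub>R C"
    using incircle_contact_point(1)[OF tri inc] by (simp add: D_def y_def z_def)
  moreover have "z / (y + z) = 1 - y / (y + z)" using pos by (simp add: field_simps)
  ultimately have "D = (1 - y / (y + z)) *\<^sub>R B + (y / (y + z)) *\<^sub>R C" by simp
  hence D: "D - A = (1 - y / (y + z)) *\<^sub>R u + (y / (y + z)) *\<^sub>R v"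
    by (simp add: u_def v_def algebra_simps)
  have "E = (x / (z + x)) *\<^sub>R C + (z / (z + x)) *\<^sub>R A"
    using incircle_contact_point(1)[OF is_triangle_rotate[OF tri] is_incircle_rotate[OF inc]]
    by (simp add: E_def x_def z_def)
  moreover have "z / (z + x) = 1 - x / (z + x)" using pos by (simp add: field_simps)
  ultimately have "E = (x / (z + x)) *\<^sub>R C + (1 - x / (z + x)) *\<^sub>R A" by simp
  hence E: "E - B = (x / (z + x)) *\<^sub>R v - u"
    by (simp add: u_def v_def algebra_simps)
  have bilinear: "cross2 ((1 - k) *\<^sub>R u + k *\<^sub>R v) (l *\<^sub>R v - u) =
      ((1 - k) * l + k) * cross2 u v" for k l
    by (simp add: cross2_def algebra_simps)
  have "cross2 (D - A) (E - B) = ((1 - y / (y + z)) * (x / (z + x)) + y / (y + z)) * cross2 u v"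
    unfolding D E by (rule bilinear)
  moreover have "cross2 u v \<noteq> 0"
    using tri collinear_if_cross2_eq_0 unfolding is_triangle_def u_def v_def by blast
  moreover have "(1 - y / (y + z)) * (x / (z + x)) + y / (y + z) > 0"
    using pos by (intro add_nonneg_pos mult_nonneg_nonneg) (simp_all add: field_simps)
  ultimately have "cross2 (D - A) (E - B) \<noteq> 0" by simp
  hence once: "G' = G" if "G' \<in> affine hull {A, D}" "G' \<in> affine hull {B, E}" for G'
    using lines_meet_once G(1,2) that unfolding D_def E_def by blast
  show ?thesis
    unfolding gergonne_point_def incenter_inradius_eqI[OF tri inc] Let_def
  proof (rule the_equality)
    show "G \<in> affine hull {A, contact_point p r B C} \<and> G \<in> affine hull {B, contact_point p r C A} \<and>
        G \<in> affine hull {C, contact_point p r A B}" using G by blast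
  qed (use once in \<open>unfold D_def E_def, blast\<close>)
qed

text \<open>
  Barycentric coordinates reciprocal to the tangent lengths, here with the denominators cleared:
  the last two weights stand in the ratio in which the contact point divides the opposite side.
\<close>

lemma gergonne_barycentric_mem_cevian:
  fixes A B C :: "real^2"
  assumes "x > 0" "y > 0" "z > 0"
  shows "(1 / (y * z + z * x + x * y)) *\<^sub>R ((y * z) *\<^sub>R A + (z * x) *\<^sub>R B + (x * y) *\<^sub>R C)
     \<in> affine hull {A, (z / (y + z)) *\<^sub>R B + (y / (y + z)) *\<^sub>R C}"
proof -
  define q where "q = y * z + z * x + x * y"
  have q: "q > 0" using assms by (simp add: q_def add_pos_pos)
  have yz: "y + z > 0" using assms by simp
  have "y * z + x * (y + z) = q" by (simp add: q_def algebra_simps)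
  hence "y * z / q + x * (y + z) / q = 1" using q by (metis add_divide_distrib divide_self less_irrefl)
  moreover have cancel: "x * n / q * (m / n) = m * x / q" if "n > 0" for m n
    using that by simp
  have "x * (y + z) / q * (z / (y + z)) = z * x / q" "x * (y + z) / q * (y / (y + z)) = x * y / q"
    using cancel[OF yz] by (simp_all add: mult.commute[of x y])
  hence "(1 / q) *\<^sub>R ((y * z) *\<^sub>R A + (z * x) *\<^sub>R B + (x * y) *\<^sub>R C) = (y * z / q) *\<^sub>R A +
     (x * (y + z) / q) *\<^sub>R ((z / (y + z)) *\<^sub>R B + (y / (y + z)) *\<^sub>R C)"
    by (simp only: scaleR_add_right scaleR_scaleR) (simp add: add.assoc)
  ultimately show ?thesis unfolding affine_hull_2 q_def by blast
qed

lemma gergonne_point_barycentric: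
  assumes tri: "is_triangle A B C"
  defines "x \<equiv> tangent_length A B C" and "y \<equiv> tangent_length B C A" and "z \<equiv> tangent_length C A B"
  shows "gergonne_point A B C =
    (1 / (y * z + z * x + x * y)) *\<^sub>R ((y * z) *\<^sub>R A + (z * x) *\<^sub>R B + (x * y) *\<^sub>R C)" (is "_ = ?G")
proof -
  obtain p r where inc: "is_incircle A B C p r" using is_incircle_exists[OF tri] .
  note tri' = is_triangle_rotate[OF tri] is_triangle_rotate[OF is_triangle_rotate[OF tri]]
  note inc' = is_incircle_rotate[OF inc] is_incircle_rotate[OF is_incircle_rotate[OF inc]]
  have pos: "x > 0" "y > 0" "z > 0"
    using tangent_length_pos tri tri' unfolding x_def y_def z_def by blast+
  have "?G \<in> affine hull {A, contact_point p r B C}"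
    using gergonne_barycentric_mem_cevian[OF pos(1) pos(2) pos(3)] incircle_contact_point(1)[OF tri inc]
    by (simp add: x_def y_def z_def)
  moreover have "?G \<in> affine hull {B, contact_point p r C A}"
    using gergonne_barycentric_mem_cevian[OF pos(2) pos(3) pos(1), of B C A]
      incircle_contact_point(1)[OF tri'(1) inc'(1)]
    by (simp add: x_def y_def z_def add_ac)
  moreover have "?G \<in> affine hull {C, contact_point p r A B}"
    using gergonne_barycentric_mem_cevian[OF pos(3) pos(1) pos(2), of C A B]
      incircle_contact_point(1)[OF tri'(2) inc'(2)]
    by (simp add: x_def y_def z_def add_ac)
  ultimately show ?thesis by (rule gergonne_point_eqI[OF tri inc])
qed

section \<open>The distance from the incenter to the Gergonne point\<close>

text \<open>
  With the incenter as origin the vertices have inner products \<open>r\<^sup>2 + x\<^sup>2\<close>, \<open>r\<^sup>2 - x * y\<close> and their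
  cyclic analogues, so the norm of the barycentric combination that gives the Gergonne point is a
  polynomial in the tangent lengths.
\<close>

lemma incenter_gergonne_tangent_lengths:
  assumes tri: "is_triangle A B C"
  defines "x \<equiv> tangent_length A B C" and "y \<equiv> tangent_length B C A" and "z \<equiv> tangent_length C A B"
  defines "q \<equiv> y * z + z * x + x * y"
  shows "q\<^sup>2 * (dist (incenter A B C) (gergonne_point A B C))\<^sup>2 =
    (inradius A B C)\<^sup>2 * q\<^sup>2 - 3 * (x * y * z)\<^sup>2"
proof -
  obtain p r where inc: "is_incircle A B C p r" using is_incircle_exists[OF tri] .
  note tri' = is_triangle_rotate[OF tri] is_triangle_rotate[OF is_triangle_rotate[OF tri]]
  have pos: "x > 0" "y > 0" "z > 0"
    using tangent_length_pos tri tri' unfolding x_def y_def z_def by blast+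
  have q: "q > 0" using pos by (simp add: q_def add_pos_pos)
  define u v w where "u = A - p" and "v = B - p" and "w = C - p"
  have sq: "u \<bullet> u = r\<^sup>2 + x\<^sup>2" "v \<bullet> v = r\<^sup>2 + y\<^sup>2" "w \<bullet> w = r\<^sup>2 + z\<^sup>2"
    using inc[unfolded is_incircle_iff[OF tri]]
    by (simp_all add: u_def v_def w_def x_def y_def z_def dist_norm power2_norm_eq_inner)
  have "(u - v) \<bullet> (u - v) = (x + y)\<^sup>2" "(v - w) \<bullet> (v - w) = (y + z)\<^sup>2" "(w - u) \<bullet> (w - u) = (z + x)\<^sup>2"
    unfolding x_def y_def z_def tangent_length_sum
    by (simp_all add: u_def v_def w_def dist_norm power2_norm_eq_inner)
  hence ip: "u \<bullet> v = r\<^sup>2 - x * y" "v \<bullet> w = r\<^sup>2 - y * z" "w \<bullet> u = r\<^sup>2 - z * x"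
    using sq by (simp_all add: inner_simps inner_commute power2_sum)
  define G where "G = gergonne_point A B C"
  have G: "q *\<^sub>R G = (y * z) *\<^sub>R A + (z * x) *\<^sub>R B + (x * y) *\<^sub>R C"
    using gergonne_point_barycentric[OF tri] q by (simp add: G_def q_def x_def y_def z_def)
  have "q *\<^sub>R (G - p) = (y * z) *\<^sub>R u + (z * x) *\<^sub>R v + (x * y) *\<^sub>R w"
    unfolding scaleR_diff_right G by (simp add: u_def v_def w_def q_def algebra_simps)
  hence "q\<^sup>2 * (dist p G)\<^sup>2 = (norm ((y * z) *\<^sub>R u + (z * x) *\<^sub>R v + (x * y) *\<^sub>R w))\<^sup>2"
    by (metis dist_norm norm_minus_commute norm_scaleR power_mult_distrib power2_abs)
  also have "\<dots> = (y * z)\<^sup>2 * (u \<bullet> u) + (z * x)\<^sup>2 * (v \<bullet> v) + (x * y)\<^sup>2 * (w \<bullet> w)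
      + 2 * (y * z) * (z * x) * (u \<bullet> v) + 2 * (z * x) * (x * y) * (v \<bullet> w) 
      + 2 * (x * y) * (y * z) * (w \<bullet> u)"
    unfolding power2_norm_eq_inner
    by (simp add: inner_add_left inner_add_right inner_commute power2_eq_square algebra_simps)
  also have "\<dots> = r\<^sup>2 * q\<^sup>2 - 3 * (x * y * z)\<^sup>2"
    unfolding sq ip q_def by algebra
  finally show ?thesis by (simp add: incenter_inradius_eqI[OF tri inc] G_def)
qed

text \<open>
  By Heron's formula \<open>4 * r * R * s\<close> is the product of the sides and \<open>r\<^sup>2 * s\<close> that of the tangent
  lengths, where \<open>s\<close> is the semiperimeter.  Their sum is \<open>s\<close> times the second elementary symmetric
  function of the tangent lengths, by the identity
  \<open>(x + y) * (y + z) * (z + x) + x * y * z = (x + y + z) * (x * y + y * z + z * x)\<close>.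
\<close>

lemma inradius_circumradius:
  assumes tri: "is_triangle A B C"
  defines "x \<equiv> tangent_length A B C" and "y \<equiv> tangent_length B C A" and "z \<equiv> tangent_length C A B"
  shows "inradius A B C * (inradius A B C + 4 * circumradius A B C) = y * z + z * x + x * y"
proof -
  obtain p r where inc: "is_incircle A B C p r" using is_incircle_exists[OF tri] .
  have r: "r > 0" using inc by (simp add: is_incircle_def)
  have pos: "x > 0" "y > 0" "z > 0"
    using tangent_length_pos tri is_triangle_rotate unfolding x_def y_def z_def by metis+
  define s where "s = x + y + z"
  have s: "s > 0" using pos by (simp add: s_def)
  define R where "R = circumradius A B C"
  have rs: "r\<^sup>2 * s = x * y * z" using incircle_radius[OF tri inc] by (simp add: s_def x_def y_def z_def)
  have "(cross2 (B - A) (C - A))\<^sup>2 = 4 * s * (r\<^sup>2 * s)"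
    unfolding rs using cross2_tangent_lengths[of B A C] by (simp add: s_def x_def y_def z_def)
  hence "\<bar>cross2 (B - A) (C - A)\<bar>\<^sup>2 = (2 * r * s)\<^sup>2" by (simp add: power2_eq_square)
  hence "\<bar>cross2 (B - A) (C - A)\<bar> = 2 * r * s"
    using r s by (subst (asm) power2_eq_iff_nonneg) auto
  hence "R * (4 * r * s) = (x + y) * (y + z) * (z + x)"
    using circumradius_cross2[OF tri] unfolding x_def y_def z_def tangent_length_sum
    by (simp add: R_def)
  hence "s * (r * (r + 4 * R)) = s * (y * z + z * x + x * y)"
    using rs unfolding s_def by algebra
  thus ?thesis using s by (simp add: incenter_inradius_eqI[OF tri inc] R_def)
qed

lemma incenter_gergonne_dist:
  assumes tri: "is_triangle A B C"
  shows "(dist (incenter A B C) (gergonne_point A B C))\<^sup>2 =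
    (inradius A B C)\<^sup>2 * (1 - 3 * (semiperimeter A B C)\<^sup>2 /
       (inradius A B C + 4 * circumradius A B C)\<^sup>2)"
proof -
  obtain p r where inc: "is_incircle A B C p r" using is_incircle_exists[OF tri] .
  have r: "inradius A B C = r" "r > 0"
    using inc incenter_inradius_eqI[OF tri inc] by (simp_all add: is_incircle_def)
  define x y z where "x = tangent_length A B C" and "y = tangent_length B C A" 
    and "z = tangent_length C A B"
  define q where "q = y * z + z * x + x * y"
  define s where "s = semiperimeter A B C"
  have "s = x + y + z"
    by (simp add: s_def x_def y_def z_def semiperimeter_def tangent_length_def field_simps)
  hence rs: "x * y * z = r\<^sup>2 * s"
    using incircle_radius[OF tri inc] by (simp add: x_def y_def z_def)
  have "x > 0" "y > 0" "z > 0"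
    using tangent_length_pos tri is_triangle_rotate unfolding x_def y_def z_def by metis+
  hence q: "q > 0" by (simp add: q_def add_pos_pos)
  have R: "r + 4 * circumradius A B C = q / r"
    using inradius_circumradius[OF tri] r by (simp add: q_def x_def y_def z_def field_simps)
  have "q\<^sup>2 * (dist (incenter A B C) (gergonne_point A B C))\<^sup>2 = r\<^sup>2 * q\<^sup>2 - 3 * (r\<^sup>2 * s)\<^sup>2"
    using incenter_gergonne_tangent_lengths[OF tri] rs r(1) by (simp add: q_def x_def y_def z_def)
  hence "(dist (incenter A B C) (gergonne_point A B C))\<^sup>2 = (r\<^sup>2 * q\<^sup>2 - 3 * (r\<^sup>2 * s)\<^sup>2) / q\<^sup>2"
    using q by (simp add: field_simps)
  also have "\<dots> = r\<^sup>2 * (1 - 3 * s\<^sup>2 / (q / r)\<^sup>2)"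
    using q r(2) by (simp add: field_simps power2_eq_square)
  finally show ?thesis by (simp add: R r(1) s_def)
qed

section \<open>The Poncelet family in the complex plane\<close>

definition complex_of_plane :: "real^2 \<Rightarrow> complex" where
  "complex_of_plane v = Complex (v $ 1) (v $ 2)"

lemma Re_complex_of_plane_mult_cnj: "Re (complex_of_plane u * cnj (complex_of_plane v)) = u \<bullet> v"
  by (simp add: complex_of_plane_def inner_real2)

lemma Im_cnj_mult_complex_of_plane: "Im (cnj (complex_of_plane u) * complex_of_plane v) = cross2 u v"
  by (simp add: complex_of_plane_def cross2_def)

lemma cmod_complex_of_plane: "cmod (complex_of_plane u) = norm u"
  by (simp add: complex_of_plane_def complex_norm norm_eq_sqrt_inner[of u] inner_real2 power2_eq_square)

lemma complex_of_plane_diff: "complex_of_plane (u - v) = complex_of_plane u - complex_of_plane v"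
  by (simp add: complex_of_plane_def complex_eq_iff)

lemma inj_complex_of_plane: "complex_of_plane u = complex_of_plane v \<longleftrightarrow> u = v"
  by (simp add: complex_of_plane_def vec_eq_iff forall_2)

text \<open>
  The tangent of the unit circle at \<open>t\<close> is \<open>m + cnj m * t\<^sup>2 = 2 * t\<close>, so the tangents at \<open>v\<close> and \<open>w\<close>
  meet in \<open>2 * v * w / (v + w)\<close>.
\<close>

lemma unit_circle_tangents_meet:
  assumes "cmod v = 1" "cmod w = 1" "v \<noteq> w" "Re (m * cnj v) = 1" "Re (m * cnj w) = 1"
  shows "m * (v + w) = 2 * v * w" "cnj m * (v + w) = 2"
proof -
  have tangent: "m + cnj m * t\<^sup>2 = 2 * t" if "cmod t = 1" "Re (m * cnj t) = 1" for t
  proof -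
    have 1: "t * cnj t = 1" using that(1) by (simp add: complex_norm_square[symmetric])
    have "m * cnj t + cnj m * t = m * cnj t + cnj (m * cnj t)" by simp
    also have "\<dots> = of_real (2 * Re (m * cnj t))" by (rule complex_add_cnj)
    also have "\<dots> = 2" using that(2) by simp
    finally have "t * (m * cnj t + cnj m * t) = 2 * t" by simp
    moreover have "t * (m * cnj t + cnj m * t) = m * (t * cnj t) + cnj m * t\<^sup>2" by algebra
    ultimately show ?thesis by (simp only: 1 mult_1_right)
  qed
  note v = tangent[OF assms(1,4)] and w = tangent[OF assms(2,5)]
  have "(v - w) * (cnj m * (v + w) - 2) = (m + cnj m * v\<^sup>2 - 2 * v) - (m + cnj m * w\<^sup>2 - 2 * w)"
    by algebra
  thus 2: "cnj m * (v + w) = 2" using assms(3) v w by simp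
  have "m * (v + w) = (m + cnj m * v\<^sup>2) * (v + w) - (cnj m * (v + w)) * v\<^sup>2" by algebra
  also have "\<dots> = 2 * v * w" unfolding v 2 by algebra
  finally show "m * (v + w) = 2 * v * w" .
qed

text \<open>
  Here \<open>m\<close> is a vertex of the triangle in coordinates in which the caustic is the unit circle.
  Substituting \<open>m = 2 * v * w / (v + w)\<close> into the equation of the ellipse gives the symmetric
  biquadratic correspondence between the two contact points seen from the vertex; the special center
  and radius of the caustic enter here and allow a factor \<open>b\<^sup>2\<close> to be cancelled.
\<close>

lemma vertex_on_ellipse:
  fixes a b k :: real and v w m :: complex
  assumes "a > 0" "b > 0" and k: "k\<^sup>2 = 4 * a^4 - 5 * a\<^sup>2 * b\<^sup>2 + b^4"
    and ell: "((k / (2 * a) + b\<^sup>2 / (2 * a) * Re m) / a)\<^sup>2 + (b\<^sup>2 / (2 * a) * Im m / b)\<^sup>2 = 1"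
    and m: "m * (v + w) = 2 * v * w" "cnj m * (v + w) = 2"
  shows "(b\<^sup>2 - 5 * a\<^sup>2) * (v + w)\<^sup>2 + 2 * k * (v + w) * (v * w + 1)
     + b\<^sup>2 * (v * w + 1)\<^sup>2 - a\<^sup>2 * (v * w - 1)\<^sup>2 = 0"
proof -
  have "((k / (2 * a) + b\<^sup>2 / (2 * a) * Re m) / a)\<^sup>2 = (k + b\<^sup>2 * Re m)\<^sup>2 / (4 * a^4)"
    using assms(1) by (simp add: power2_eq_square power4_eq_xxxx field_simps)
  moreover have "(b\<^sup>2 / (2 * a) * Im m / b)\<^sup>2 = a\<^sup>2 * b\<^sup>2 * (Im m)\<^sup>2 / (4 * a^4)"
    using assms(1,2) by (simp add: power2_eq_square power4_eq_xxxx field_simps)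
  ultimately have "(k + b\<^sup>2 * Re m)\<^sup>2 + a\<^sup>2 * b\<^sup>2 * (Im m)\<^sup>2 = 4 * a^4"
    using ell assms(1) by (simp add: add_divide_distrib[symmetric])
  hence "complex_of_real ((k + b\<^sup>2 * Re m)\<^sup>2 + a\<^sup>2 * b\<^sup>2 * (Im m)\<^sup>2) = complex_of_real (4 * a^4)"
    by (simp only:)
  note E = this[unfolded of_real_add of_real_mult of_real_power of_real_numeral]
  \<comment> \<open>with the factor \<open>\<i>\<close> absorbed into \<open>y\<close> the rest is polynomial algebra\<close>
  define x y a' b' k' where "x = complex_of_real (Re m)" and "y = \<i> * complex_of_real (Im m)"
    and "a' = complex_of_real a" and "b' = complex_of_real b" and "k' = complex_of_real k"
  have "m = x + y" "cnj m = x - y" by (simp_all add: x_def y_def complex_eq_iff)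
  hence S: "(x + y) * (v + w) = 2 * v * w" "(x - y) * (v + w) = 2" using m by simp_all
  have "2 * (x * (v + w)) = (x + y) * (v + w) + (x - y) * (v + w)"
    "2 * (y * (v + w)) = (x + y) * (v + w) - (x - y) * (v + w)" by algebra+
  hence "2 * (x * (v + w)) = 2 * (v * w + 1)" "2 * (y * (v + w)) = 2 * (v * w - 1)"
    unfolding S by (simp_all add: algebra_simps)
  hence X: "x * (v + w) = v * w + 1" and Y: "y * (v + w) = v * w - 1"
    unfolding mult_cancel_left by simp_all
  have E': "(k' + b'\<^sup>2 * x)\<^sup>2 - a'\<^sup>2 * b'\<^sup>2 * y\<^sup>2 = 4 * a'^4"
    using E by (simp add: x_def y_def a'_def b'_def k'_def power_mult_distrib)
  have "(k' * (v + w) + b'\<^sup>2 * (v * w + 1))\<^sup>2 - a'\<^sup>2 * b'\<^sup>2 * (v * w - 1)\<^sup>2 = 4 * a'^4 * (v + w)\<^sup>2"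
    unfolding E'[symmetric] X[symmetric] Y[symmetric] by algebra
  moreover have "k'\<^sup>2 = 4 * a'^4 - 5 * a'\<^sup>2 * b'\<^sup>2 + b'^4"
    using arg_cong[OF k, of complex_of_real] by (simp add: a'_def b'_def k'_def)
  ultimately have "b'\<^sup>2 * ((b'\<^sup>2 - 5 * a'\<^sup>2) * (v + w)\<^sup>2 + 2 * k' * (v + w) * (v * w + 1)
     + b'\<^sup>2 * (v * w + 1)\<^sup>2 - a'\<^sup>2 * (v * w - 1)\<^sup>2) = 0" by algebra
  moreover have "b' \<noteq> 0" using assms(2) by (simp add: b'_def)
  ultimately show ?thesis by (simp add: a'_def b'_def k'_def)
qed

text \<open>
  Taking divided differences of the correspondence twice, once in each argument, eliminates
  everything except one linear relation between the first two elementary symmetric functions of the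
  contact points.  It is here that the symmetric relation between pairs becomes a relation for the
  whole triangle.
\<close>

lemma poncelet_contact_relation:
  fixes a b k u v w :: "'a :: field"
  assumes k: "k\<^sup>2 = 4 * a^4 - 5 * a\<^sup>2 * b\<^sup>2 + b^4" and ab: "a\<^sup>2 \<noteq> b\<^sup>2"
    and dist: "u \<noteq> v" "v \<noteq> w" "w \<noteq> u"
  defines "F \<equiv> \<lambda>v w. (b\<^sup>2 - 5 * a\<^sup>2) * (v + w)\<^sup>2 + 2 * k * (v + w) * (v * w + 1)
     + b\<^sup>2 * (v * w + 1)\<^sup>2 - a\<^sup>2 * (v * w - 1)\<^sup>2"
  assumes F: "F u v = 0" "F v w = 0" "F w u = 0"
  shows "k * (u * v + v * w + w * u + 3) = 2 * (4 * a\<^sup>2 - b\<^sup>2) * (u + v + w)"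
proof -
  \<comment> \<open>the divided difference of \<open>F u\<close> between \<open>v\<close> and \<open>w\<close>\<close>
  define G where "G = (\<lambda>u v w. (b\<^sup>2 - a\<^sup>2) * u\<^sup>2 * (v + w) + 2 * k * u * (u + v + w)
    + (b\<^sup>2 - 5 * a\<^sup>2) * (v + w) + (4 * b\<^sup>2 - 8 * a\<^sup>2) * u + 2 * k)"
  have "F u v - F w u = (v - w) * G u v w" "F u v - F v w = (u - w) * G v u w"
    unfolding F_def G_def by algebra+
  hence "G u v w = 0" "G v u w = 0" using F dist by auto
  moreover have "G u v w - G v u w =
      (u - v) * ((b\<^sup>2 - a\<^sup>2) * (u * v + v * w + w * u + 3) + 2 * k * (u + v + w))"
    unfolding G_def by algebra
  ultimately have "(b\<^sup>2 - a\<^sup>2) * (u * v + v * w + w * u + 3) + 2 * k * (u + v + w) = 0"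
    using dist by simp
  hence "(b\<^sup>2 - a\<^sup>2) * (k * (u * v + v * w + w * u + 3) - 2 * (4 * a\<^sup>2 - b\<^sup>2) * (u + v + w)) = 0"
    using k by algebra
  thus ?thesis using ab by simp
qed

text \<open>
  The condition that the real point \<open>K\<close> lies on the line through the contact point \<open>u\<close> and the opposite
  vertex \<open>m\<close> is, after clearing denominators, the linear combination of the last hypothesis and its
  complex conjugate that is displayed in the proof.  Both are symmetric in the contact points, so \<open>K\<close> lies
  on all three cevians at once.
\<close>

lemma cevian_through_real_point:
  fixes K :: real and u v w m :: complex
  assumes unit: "cmod u = 1" "cmod v = 1" "cmod w = 1"
    and m: "m * (v + w) = 2 * v * w" "cnj m * (v + w) = 2"
    and K: "K * (u * v + v * w + w * u + 3) = 2 * (u + v + w)"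
  shows "Im (cnj (m - u) * (K - u)) = 0"
proof -
  have inv: "u * cnj u = 1" "v * cnj v = 1" "w * cnj w = 1"
    using unit by (simp_all add: complex_norm_square[symmetric])
  have "K * (cnj u * cnj v + cnj v * cnj w + cnj w * cnj u + 3) = 2 * (cnj u + cnj v + cnj w)"
    using arg_cong[OF K, of cnj] by simp
  hence "u * v * w * (K * (cnj u * cnj v + cnj v * cnj w + cnj w * cnj u + 3)) =
      u * v * w * (2 * (cnj u + cnj v + cnj w))" by simp
  hence "K * ((u * cnj u) * (v * cnj v) * w + (v * cnj v) * (w * cnj w) * u +
        (w * cnj w) * (u * cnj u) * v + 3 * (u * v * w)) =
      2 * (v * w * (u * cnj u) + w * u * (v * cnj v) + u * v * (w * cnj w))"
    by (simp add: algebra_simps)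
  hence K': "K * (u + v + w + 3 * (u * v * w)) = 2 * (u * v + v * w + w * u)"
    unfolding inv by (simp add: algebra_simps)
  have "u * (v + w) * ((cnj m - cnj u) * (K - u) - (m - u) * (K - cnj u)) = 
     u * (K * (u * v + v * w + w * u + 3) - 2 * (u + v + w)) -
      (K * (u + v + w + 3 * (u * v * w)) - 2 * (u * v + v * w + w * u))"
  proof -
    have "u * (v + w) * ((cnj m - cnj u) * (K - u) - (m - u) * (K - cnj u)) =
        (u * (cnj m * (v + w)) - u * cnj u * (v + w)) * (K - u) -
        (m * (v + w) - u * (v + w)) * (u * K - u * cnj u)" by algebra
    also have "\<dots> = (u * 2 - (v + w)) * (K - u) - (2 * v * w - u * (v + w)) * (u * K - 1)"
      unfolding m inv by simp
    also have "\<dots> = u * (K * (u * v + v * w + w * u + 3) - 2 * (u + v + w)) -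
        (K * (u + v + w + 3 * (u * v * w)) - 2 * (u * v + v * w + w * u))" by algebra
    finally show ?thesis .
  qed
  also have "\<dots> = 0" using K K' by simp
  finally have "(cnj m - cnj u) * (K - u) - (m - u) * (K - cnj u) = 0"
    using m(2) inv(1) by auto
  hence "cnj (m - u) * (K - u) = cnj (cnj (m - u) * (K - u))" by simp
  thus ?thesis by (metis Reals_cnj_iff complex_is_Real_iff)
qed

text \<open>
  A common point of contact of two sides would have all three vertices on its tangent line.
\<close>

lemma incircle_contact_points_distinct:
  assumes tri: "is_triangle A B C" and inc: "is_incircle A B C p r"
  shows "contact_point p r B C \<noteq> contact_point p r C A"
proof
  define D where "D = contact_point p r B C"
  assume eq: "contact_point p r B C = contact_point p r C A"
  have "(B - p) \<bullet> (D - p) = r\<^sup>2" "(C - p) \<bullet> (D - p) = r\<^sup>2" "(A - p) \<bullet> (D - p) = r\<^sup>2"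
    using incircle_contact_point[OF tri inc] eq
      incircle_contact_point[OF is_triangle_rotate[OF tri] is_incircle_rotate[OF inc]]
    by (simp_all add: D_def)
  hence "(D - p) \<bullet> (B - A) = 0" "(D - p) \<bullet> (C - A) = 0"
    by (simp_all add: inner_diff_right inner_diff_left inner_commute)
  hence "D = p" using orthogonal_to_two_sides_eq_0[OF tri] by force
  moreover have "dist D p = r" "r > 0"
    using incircle_contact_point(4)[OF tri inc] inc by (simp_all add: D_def is_incircle_def)
  ultimately show False by simp
qed

text \<open>
  The map \<open>f\<close> normalizes the caustic to the unit circle, and the point in the statement becomes the
  real number \<open>K = k / (4 * a\<^sup>2 - b\<^sup>2)\<close> that the contact relation singles out.
\<close>

lemma poncelet_cevian:
  fixes a b k :: real
  assumes ab: "a > b" "b > 0" and k: "k\<^sup>2 = 4 * a^4 - 5 * a\<^sup>2 * b\<^sup>2 + b^4"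
  defines "p \<equiv> vector [k / (2 * a), 0]" and "r \<equiv> b\<^sup>2 / (2 * a)"
  assumes mem: "(A, B, C) \<in> poncelet_triangles (ellipse a b) p r"
  shows "vector [k / (2 * a) + r * (k / (4 * a\<^sup>2 - b\<^sup>2)), 0] \<in> affine hull {A, contact_point p r B C}"
proof -
  have tri: "is_triangle A B C" and inc: "is_incircle A B C p r"
    and on: "A \<in> ellipse a b" "B \<in> ellipse a b" "C \<in> ellipse a b"
    using mem by (auto simp: poncelet_triangles_def)
  note tri' = is_triangle_rotate[OF tri] is_triangle_rotate[OF is_triangle_rotate[OF tri]]
  note inc' = is_incircle_rotate[OF inc] is_incircle_rotate[OF is_incircle_rotate[OF inc]]
  have r: "r > 0" using inc by (simp add: is_incircle_def)
  have ab2: "b\<^sup>2 < a\<^sup>2" using ab by (simp add: power_strict_mono)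
  define D E F where "D = contact_point p r B C" and "E = contact_point p r C A" 
    and "F = contact_point p r A B"
  define f where "f = (\<lambda>X. complex_of_plane (X - p) / r)"
  have Re_f: "Re (f X * cnj (f Y)) = ((X - p) \<bullet> (Y - p)) / r\<^sup>2" for X Y
    unfolding f_def Re_complex_of_plane_mult_cnj[symmetric] by (simp add: power2_eq_square)
  have cmod_f: "cmod (f X) = dist X p / r" for X
    using r by (simp add: f_def norm_divide cmod_complex_of_plane dist_norm)
  have inj_f: "f X = f Y \<longleftrightarrow> X = Y" for X Y
    using r by (simp add: f_def inj_complex_of_plane)
  have unit: "cmod (f D) = 1" "cmod (f E) = 1" "cmod (f F) = 1"
    using incircle_contact_point(4)[OF tri inc] incircle_contact_point(4)[OF tri'(1) inc'(1)]
      incircle_contact_point(4)[OF tri'(2) inc'(2)] r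
    by (simp_all add: cmod_f D_def E_def F_def)
  have "D \<noteq> E" "E \<noteq> F" "F \<noteq> D"
    using incircle_contact_points_distinct[OF tri inc] incircle_contact_points_distinct[OF tri'(1) inc'(1)]
      incircle_contact_points_distinct[OF tri'(2) inc'(2)] unfolding D_def E_def F_def by blast+
  hence distinct: "f D \<noteq> f E" "f E \<noteq> f F" "f F \<noteq> f D" by (simp_all add: inj_f)
  have "Re (f A * cnj (f E)) = 1" "Re (f A * cnj (f F)) = 1"
    "Re (f B * cnj (f F)) = 1" "Re (f B * cnj (f D)) = 1"
    "Re (f C * cnj (f D)) = 1" "Re (f C * cnj (f E)) = 1"
    using incircle_contact_point(2,3)[OF tri inc] incircle_contact_point(2,3)[OF tri'(1) inc'(1)]
      incircle_contact_point(2,3)[OF tri'(2) inc'(2)] r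
    unfolding Re_f D_def E_def F_def by simp_all
  note vertex = unit_circle_tangents_meet[OF unit(2,3) distinct(2) this(1,2)]
    unit_circle_tangents_meet[OF unit(3,1) distinct(3) this(3,4)]
    unit_circle_tangents_meet[OF unit(1,2) distinct(1) this(5,6)]
  have ell: "((k / (2 * a) + b\<^sup>2 / (2 * a) * Re (f X)) / a)\<^sup>2 + (b\<^sup>2 / (2 * a) * Im (f X) / b)\<^sup>2 = 1"
    if "X \<in> ellipse a b" for X
  proof -
    have "r * Re (f X) = X $ 1 - k / (2 * a)" "r * Im (f X) = X $ 2"
      using r by (simp_all add: f_def complex_of_plane_def p_def)
    thus ?thesis using that by (simp add: ellipse_def r_def[symmetric])
  qed
  have "a > 0" using ab by simp
  note F = vertex_on_ellipse[OF this ab(2) k]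
  have "(of_real k)\<^sup>2 = 4 * complex_of_real a ^ 4 - 5 * (of_real a)\<^sup>2 * (of_real b)\<^sup>2 + of_real b ^ 4"
    using arg_cong[OF k, of complex_of_real] by simp
  moreover have "(complex_of_real a)\<^sup>2 \<noteq> (of_real b)\<^sup>2"
    using ab2 by (simp flip: of_real_power)
  ultimately have rel: "of_real k * (f D * f E + f E * f F + f F * f D + 3) =
      2 * (4 * (of_real a)\<^sup>2 - (of_real b)\<^sup>2) * (f D + f E + f F)"
    using F[OF ell[OF on(1)] vertex(1,2)] F[OF ell[OF on(2)] vertex(3,4)]
      F[OF ell[OF on(3)] vertex(5,6)] distinct
    by (intro poncelet_contact_relation) simp_all
  define K where "K = k / (4 * a\<^sup>2 - b\<^sup>2)"
  have den: "4 * a\<^sup>2 - b\<^sup>2 > 0" using ab2 zero_le_power2[of a] by linarith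
  hence "k = K * (4 * a\<^sup>2 - b\<^sup>2)" by (simp add: K_def)
  hence kK: "of_real k = of_real K * (4 * (of_real a)\<^sup>2 - (complex_of_real b)\<^sup>2)" by simp
  have "4 * (of_real a)\<^sup>2 - (complex_of_real b)\<^sup>2 \<noteq> 0"
  proof -
    have "4 * (of_real a)\<^sup>2 - (complex_of_real b)\<^sup>2 = of_real (4 * a\<^sup>2 - b\<^sup>2)" by simp
    thus ?thesis using den by (simp only: of_real_eq_0_iff)
  qed
  moreover have "(4 * (of_real a)\<^sup>2 - (complex_of_real b)\<^sup>2) *
      (of_real K * (f D * f E + f E * f F + f F * f D + 3)) =
      (4 * (of_real a)\<^sup>2 - (of_real b)\<^sup>2) * (2 * (f D + f E + f F))"
    using rel unfolding kK by (simp only: ac_simps)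
  ultimately have "of_real K * (f D * f E + f E * f F + f F * f D + 3) = 2 * (f D + f E + f F)"
    unfolding mult_cancel_left by blast
  note cevian = cevian_through_real_point[OF unit vertex(1,2) this]
  define G :: "real^2" where "G = vector [k / (2 * a) + r * K, 0]"
  have fG: "f G = of_real K"
    using r by (simp add: f_def complex_of_plane_def G_def p_def complex_eq_iff)
  have diff: "complex_of_plane (X - D) = r * (f X - f D)" for X
    using r by (simp add: f_def complex_of_plane_diff[symmetric] diff_divide_distrib[symmetric])
  have "cross2 (A - D) (G - D) = r\<^sup>2 * Im (cnj (f A - f D) * (f G - f D))"
    unfolding Im_cnj_mult_complex_of_plane[symmetric] diff by (simp add: power2_eq_square algebra_simps)
  also have "\<dots> = 0" unfolding fG using cevian by simp
  finally have "collinear {A, D, G}" using collinear_if_cross2_eq_0[of A D G] 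
    by (simp add: insert_commute)
  moreover have "A \<noteq> D"
  proof
    assume "A = D"
    moreover have "dist D p = r" using incircle_contact_point(4)[OF tri inc] by (simp add: D_def)
    ultimately have "tangent_length A B C = 0" using inc[unfolded is_incircle_iff[OF tri]] by simp
    thus False using tangent_length_pos[OF tri] by simp
  qed
  ultimately have "G \<in> affine hull {A, D}" using collinear_3_affine_hull by blast
  thus ?thesis by (simp add: G_def K_def D_def)
qed

text \<open>
  The Gergonne point does not depend on the triangle: the family is closed under rotating the
  vertices, so the point that lies on one cevian lies on all of them.
\<close>

lemma poncelet_gergonne_point:
  fixes a b k :: real
  assumes ab: "a > b" "b > 0" and k: "k\<^sup>2 = 4 * a^4 - 5 * a\<^sup>2 * b\<^sup>2 + b^4"
  defines "p \<equiv> vector [k / (2 * a), 0]" and "r \<equiv> b\<^sup>2 / (2 * a)"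
  assumes mem: "(A, B, C) \<in> poncelet_triangles (ellipse a b) p r"
  shows "gergonne_point A B C = vector [k / (2 * a) + r * (k / (4 * a\<^sup>2 - b\<^sup>2)), 0]"
proof -
  have rotate: "(B, C, A) \<in> poncelet_triangles (ellipse a b) p r"
    if "(A, B, C) \<in> poncelet_triangles (ellipse a b) p r" for A B C
    using that is_triangle_rotate is_incircle_rotate by (auto simp: poncelet_triangles_def)
  note cevian = poncelet_cevian[OF ab k, folded p_def r_def]
  have "is_triangle A B C" "is_incircle A B C p r"
    using mem by (auto simp: poncelet_triangles_def)
  thus ?thesis
    using cevian[OF mem] cevian[OF rotate[OF mem]] cevian[OF rotate[OF rotate[OF mem]]]
    by (rule gergonne_point_eqI)
qed

theorem proposition10:
  fixes a b c k7 :: real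
  assumes "a > b" and "b > 0"
    and "c = sqrt (a\<^sup>2 - b\<^sup>2)"
    and "k7 = sqrt (4 * a^4 - 5 * a\<^sup>2 * b\<^sup>2 + b^4)"
  shows "(\<forall>A B C. is_triangle A B C \<longrightarrow>
            (dist (incenter A B C) (gergonne_point A B C))\<^sup>2 =
              (inradius A B C)\<^sup>2 *
                (1 - 3 * (semiperimeter A B C)\<^sup>2 /
                       (inradius A B C + 4 * circumradius A B C)\<^sup>2)) \<and>
         (\<forall>(A, B, C) \<in> poncelet_triangles (ellipse a b)
                           (vector [k7 / (2 * a), 0]) (b\<^sup>2 / (2 * a)).
            (dist (incenter A B C) (gergonne_point A B C))\<^sup>2 =
              b^4 * c\<^sup>2 / (4 * a\<^sup>2 * (4 * a\<^sup>2 - b\<^sup>2)))"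
proof (intro conjI allI impI, goal_cases)
  case (1 A B C)
  thus ?case by (rule incenter_gergonne_dist)
next
  case 2
  have ab2: "b\<^sup>2 < a\<^sup>2" using assms(1,2) by (simp add: power_strict_mono)
  define e where "e = 4 * a\<^sup>2 - b\<^sup>2"
  have e: "e > 0" using ab2 zero_le_power2[of a] unfolding e_def by linarith
  have c: "c\<^sup>2 = a\<^sup>2 - b\<^sup>2" using ab2 assms(3) by simp
  have factor: "4 * a^4 - 5 * a\<^sup>2 * b\<^sup>2 + b^4 = e * c\<^sup>2" unfolding c e_def by algebra
  hence k: "k7\<^sup>2 = 4 * a^4 - 5 * a\<^sup>2 * b\<^sup>2 + b^4" using assms(4) e by simp
  show ?case
  proof (clarify)
    fix A B C
    assume mem: "(A, B, C) \<in> poncelet_triangles (ellipse a b) (vector [k7 / (2 * a), 0]) (b\<^sup>2 / (2 * a))"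
    hence "is_triangle A B C" "is_incircle A B C (vector [k7 / (2 * a), 0]) (b\<^sup>2 / (2 * a))"
      by (auto simp: poncelet_triangles_def)
    hence "incenter A B C = vector [k7 / (2 * a), 0]" by (rule incenter_inradius_eqI)
    hence "dist (incenter A B C) (gergonne_point A B C) = \<bar>b\<^sup>2 / (2 * a) * (k7 / e)\<bar>"
      using poncelet_gergonne_point[OF assms(1,2) k mem]
      by (simp add: dist_norm norm_eq_sqrt_inner inner_real2 e_def flip: power2_eq_square)
    hence "(dist (incenter A B C) (gergonne_point A B C))\<^sup>2 = b^4 * (e * c\<^sup>2) / (4 * a\<^sup>2 * e\<^sup>2)"
      by (simp add: power_mult_distrib power_divide k factor)
    also have "\<dots> = b^4 * c\<^sup>2 / (4 * a\<^sup>2 * e)" using e by (simp add: power2_eq_square)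
    finally show "(dist (incenter A B C) (gergonne_point A B C))\<^sup>2 =
        b^4 * c\<^sup>2 / (4 * a\<^sup>2 * (4 * a\<^sup>2 - b\<^sup>2))" by (simp add: e_def)
  qed
qed

end
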